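(* Let $\alpha\in(0,1)$ and let $p_n=\mathbb{P}\{S_{n+1}\ge S_n'+1\}=\mathbb{P}\{S_{n+1}>S_n'\}$ for $n=1,2,\dots$. The sequence $(p_n)_{n\ge1}$ is monotone and convex/concave; precisely: (i) if $\alpha<1/2$, then $(p_n)_{n\ge 1}$ is (strictly) increasing and concave; (ii) if $\alpha>1/2$, then $(p_n)_{n\ge 1}$ is (strictly) decreasing and convex; (iii) if $\alpha=1/2$, then $p_n=1/2$ for all $n\ge 1$.
   Context: Let $\{X_i,X_i'\}_{i\ge1}$ be independent identically distributed random variables with $\mathbb{P}\{X_i=1\}=\alpha$ and $\mathbb{P}\{X_i=0\}=1-\alpha$. Put $S_k=X_1+\dots+X_k$ and $S_n'=X_1'+\dots+X_n'$, so that $S_k$ and $S_n'$ are independent binomial random variables. "Increasing/decreasing" mean strictly increasing/strictly decreasing. A sequence $(a_n)$ is convex (respectively concave) if the differences $a_{n+1}-a_n$ are nondecreasing (respectively nonincreasing) in $n$. *)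

theory Defs
  imports "HOL-Probability.Probability"
begin

definition partial_sum :: "(nat \<Rightarrow> 'a \<Rightarrow> real) \<Rightarrow> nat \<Rightarrow> 'a \<Rightarrow> real" where
  "partial_sum X k \<omega> = (\<Sum>i=1..k. X i \<omega>)"

text \<open>
  The family consisting of all \<open>X i\<close> and all \<open>X' i\<close> with \<open>i \<ge> 1\<close> is jointly independent; its index
  set is the disjoint sum of two copies of the positive naturals. The predicate
  \<^const>\<open>prob_space.indep_vars\<close> includes measurability of every member of the family, and identical
  distribution is expressed by the common Bernoulli law. The variables are real-valued, so they
  take values in \<open>{0, 1}\<close> only almost surely.
\<close>

definition iid_bernoulli_pair ::
    "'a measure \<Rightarrow> real \<Rightarrow> (nat \<Rightarrow> 'a \<Rightarrow> real) \<Rightarrow> (nat \<Rightarrow> 'a \<Rightarrow> real) \<Rightarrow> bool" where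
  "iid_bernoulli_pair M \<alpha> X X' \<longleftrightarrow>
     prob_space.indep_vars M (\<lambda>_. borel) (case_sum X X') ({1..} <+> {1..}) \<and>
     (\<forall>i\<ge>1. \<P>(\<omega> in M. X i \<omega> = 1) = \<alpha> \<and> \<P>(\<omega> in M. X i \<omega> = 0) = 1 - \<alpha> \<and>
            \<P>(\<omega> in M. X' i \<omega> = 1) = \<alpha> \<and> \<P>(\<omega> in M. X' i \<omega> = 0) = 1 - \<alpha>)"

definition win_prob ::
    "'a measure \<Rightarrow> (nat \<Rightarrow> 'a \<Rightarrow> real) \<Rightarrow> (nat \<Rightarrow> 'a \<Rightarrow> real) \<Rightarrow> nat \<Rightarrow> real" where
  "win_prob M X X' n = \<P>(\<omega> in M. partial_sum X (n + 1) \<omega> \<ge> partial_sum X' n \<omega> + 1)"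

text \<open>Sequences are indexed by \<open>n \<ge> 1\<close>; the value at \<open>0\<close> is irrelevant.\<close>

definition convex_seq :: "(nat \<Rightarrow> real) \<Rightarrow> bool" where
  "convex_seq a \<longleftrightarrow> mono_on {1..} (\<lambda>n. a (n + 1) - a n)"

definition concave_seq :: "(nat \<Rightarrow> real) \<Rightarrow> bool" where
  "concave_seq a \<longleftrightarrow> antimono_on {1..} (\<lambda>n. a (n + 1) - a n)"

end

theory Submission
  imports Defs
begin

text \<open>
  Put \<open>D\<^sub>n = S\<^sub>n - S'\<^sub>n\<close> and \<open>q\<^sub>n = P(D\<^sub>n = 0)\<close>. As \<open>D\<^sub>n\<close> is symmetric and integer-valued, conditioning on
  \<open>X\<^sub>n\<^sub>+\<^sub>1\<close> gives \<open>p\<^sub>n = P(D\<^sub>n > 0) + \<alpha> q\<^sub>n = 1/2 - (1/2 - \<alpha>) q\<^sub>n\<close>. The characteristic function of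
  \<open>D\<^sub>n\<close> is \<open>f(t)\<^sup>n\<close> with \<open>f(t) = |1 - \<alpha> + \<alpha> e\<^sup>i\<^sup>t|\<^sup>2 \<in> [0, 1]\<close>, so Fourier inversion gives
  \<open>2\<pi> q\<^sub>n = \<integral> f(t)\<^sup>n dt\<close> over \<open>[-\<pi>, \<pi>]\<close>: a sequence of moments of a \<open>[0, 1]\<close>-valued function, hence
  decreasing and convex.
\<close>

section \<open>Moments of a function with values in the unit interval\<close>

lemma integral_power_diff:
  fixes f :: "real \<Rightarrow> real"
  assumes "continuous_on {a..b} f"
  shows "integral {a..b} (\<lambda>t. f t ^ n) - integral {a..b} (\<lambda>t. f t ^ Suc n)
       = integral {a..b} (\<lambda>t. f t ^ n * (1 - f t))"
proof -
  have "integral {a..b} (\<lambda>t. f t ^ n) - integral {a..b} (\<lambda>t. f t ^ Suc n)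
      = integral {a..b} (\<lambda>t. f t ^ n - f t ^ Suc n)"
    by (intro integral_diff[symmetric] integrable_continuous_real continuous_intros assms)
  then show ?thesis
    by (simp add: algebra_simps)
qed

text \<open>The two integrals differ by the integral of \<open>f t ^ n * (1 - f t)\<close>, which is
  continuous and nonnegative. The point \<open>s\<close> shows that it is not identically zero, so
  its integral is positive.\<close>

lemma integral_power_strict_antimono:
  fixes f :: "real \<Rightarrow> real"
  assumes f: "continuous_on {a..b} f" and "a < b"
    and bounds: "\<And>t. t \<in> {a..b} \<Longrightarrow> 0 \<le> f t \<and> f t \<le> 1"
    and s: "s \<in> {a..b}" "0 < f s" "f s < 1"
  shows "integral {a..b} (\<lambda>t. f t ^ Suc n) < integral {a..b} (\<lambda>t. f t ^ n)"
proof -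
  let ?g = "\<lambda>t. f t ^ n * (1 - f t)"
  have "?g s \<noteq> 0"
    using s by simp
  then have "integral {a..b} ?g \<noteq> 0"
    using s(1) bounds \<open>a < b\<close>
    by (subst integral_eq_0_iff) (auto intro!: continuous_intros f)
  moreover have "integral {a..b} ?g \<ge> 0"
    using bounds by (intro integral_nonneg integrable_continuous_real continuous_intros f) auto
  ultimately show ?thesis
    using integral_power_diff[OF f, of n] by linarith
qed

text \<open>Each difference is minus the integral of \<open>f t ^ n * (1 - f t)\<close>, and this
  integrand shrinks pointwise as \<open>n\<close> grows.\<close>

lemma integral_power_convex:
  fixes f :: "real \<Rightarrow> real"
  assumes f: "continuous_on {a..b} f"
    and bounds: "\<And>t. t \<in> {a..b} \<Longrightarrow> 0 \<le> f t \<and> f t \<le> 1"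
  shows "mono (\<lambda>n. integral {a..b} (\<lambda>t. f t ^ (n + 1)) - integral {a..b} (\<lambda>t. f t ^ n))"
proof (rule monoI)
  fix m n :: nat
  assume "m \<le> n"
  have "integral {a..b} (\<lambda>t. f t ^ n * (1 - f t)) \<le> integral {a..b} (\<lambda>t. f t ^ m * (1 - f t))"
    using bounds \<open>m \<le> n\<close>
    by (intro integral_le integrable_continuous_real continuous_intros f mult_right_mono
        power_decreasing) auto
  then show "integral {a..b} (\<lambda>t. f t ^ (m + 1)) - integral {a..b} (\<lambda>t. f t ^ m)
      \<le> integral {a..b} (\<lambda>t. f t ^ (n + 1)) - integral {a..b} (\<lambda>t. f t ^ n)"
    using integral_power_diff[OF f, of n] integral_power_diff[OF f, of m] by simp
qed

section \<open>Adding an independent two-valued variable\<close>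

context prob_space
begin

text \<open>The two events are disjoint and their probabilities add up to 1.\<close>

lemma AE_two_valued:
  fixes Z :: "'a \<Rightarrow> real"
  assumes [measurable]: "random_variable borel Z"
    and Z: "\<P>(\<omega> in M. Z \<omega> = c) = a" "\<P>(\<omega> in M. Z \<omega> = d) = 1 - a" and "c \<noteq> d"
  shows "AE \<omega> in M. Z \<omega> = c \<or> Z \<omega> = d"
proof -
  have "\<P>(\<omega> in M. Z \<omega> = c \<or> Z \<omega> = d)
      = prob ({\<omega> \<in> space M. Z \<omega> = c} \<union> {\<omega> \<in> space M. Z \<omega> = d})"
    by (auto intro: arg_cong[where f = prob])
  also have "\<dots> = 1"
    using \<open>c \<noteq> d\<close> by (subst finite_measure_Union) (auto simp: Z)
  finally show ?thesis
    by (auto dest: AE_prob_1)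
qed

text \<open>Condition on the value of \<open>Z\<close>. The nonzero value \<open>c\<close> stays
  general to cover both \<open>X i\<close> (\<open>c = 1\<close>) and \<open>- X' i\<close>
  (\<open>c = -1\<close>).\<close>

lemma prob_add_two_valued:
  fixes Y Z :: "'a \<Rightarrow> real"
  assumes indep: "indep_var borel Z borel Y"
    and Z: "\<P>(\<omega> in M. Z \<omega> = c) = a" "\<P>(\<omega> in M. Z \<omega> = 0) = 1 - a" and "c \<noteq> 0"
    and A[measurable]: "A \<in> sets borel"
  shows "\<P>(\<omega> in M. Y \<omega> + Z \<omega> \<in> A)
       = (1 - a) * \<P>(\<omega> in M. Y \<omega> \<in> A) + a * \<P>(\<omega> in M. Y \<omega> + c \<in> A)"
proof -
  have [measurable]: "random_variable borel Y" "random_variable borel Z"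
    using indep_var_rv1[OF indep] indep_var_rv2[OF indep] by auto
  have split: "\<P>(\<omega> in M. Y \<omega> + d \<in> A \<and> Z \<omega> = d)
      = \<P>(\<omega> in M. Z \<omega> = d) * \<P>(\<omega> in M. Y \<omega> + d \<in> A)" for d
  proof -
    have "(\<lambda>y. y + d) -` A \<in> sets borel"
      by (rule measurable_sets_borel[OF _ A]) measurable
    from prob_indep_random_variable[OF indep _ this, of "{d}"] show ?thesis
      by (simp add: conj_commute)
  qed
  \<comment> \<open>Off a null set \<open>Z\<close> is 0 or \<open>c\<close>; since
    \<open>c \<noteq> 0\<close>, the two cases are disjoint.\<close>
  have "\<P>(\<omega> in M. Y \<omega> + Z \<omega> \<in> A)
      = \<P>(\<omega> in M. Y \<omega> + 0 \<in> A \<and> Z \<omega> = 0 \<or> Y \<omega> + c \<in> A \<and> Z \<omega> = c)"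
    using AE_two_valued[OF _ Z] \<open>c \<noteq> 0\<close> by (intro prob_eq_AE) auto
  also have "\<dots> = prob ({\<omega> \<in> space M. Y \<omega> + 0 \<in> A \<and> Z \<omega> = 0} \<union>
      {\<omega> \<in> space M. Y \<omega> + c \<in> A \<and> Z \<omega> = c})"
    by (auto intro: arg_cong[where f = prob])
  also have "\<dots> = \<P>(\<omega> in M. Y \<omega> + 0 \<in> A \<and> Z \<omega> = 0) + \<P>(\<omega> in M. Y \<omega> + c \<in> A \<and> Z \<omega> = c)"
    using \<open>c \<noteq> 0\<close> by (intro finite_measure_Union) auto
  finally show ?thesis
    unfolding split by (simp add: Z)
qed

end

section \<open>The difference of the two partial sums\<close>

locale bernoulli_pair = prob_space M for M :: "'a measure" +
  fixes X X' :: "nat \<Rightarrow> 'a \<Rightarrow> real" and \<alpha> :: real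
  assumes \<alpha>: "0 < \<alpha>" "\<alpha> < 1"
    and iid: "iid_bernoulli_pair M \<alpha> X X'"
begin

text \<open>Absorbing the signs into one jointly independent family makes \<open>D n\<close> and
  \<open>D n\<close> plus \<open>X (n + 1)\<close> plain finite sums, so the next term is
  independent of them because its index is new.\<close>

definition V :: "nat + nat \<Rightarrow> 'a \<Rightarrow> real" where
  "V = case_sum X (\<lambda>i \<omega>. - X' i \<omega>)"

definition D :: "nat \<Rightarrow> 'a \<Rightarrow> real" where
  "D n \<omega> = partial_sum X n \<omega> - partial_sum X' n \<omega>"

lemma D_eq_sum: "D n = (\<lambda>\<omega>. \<Sum>j\<in>{1..n} <+> {1..n}. V j \<omega>)"
  by (simp add: fun_eq_iff D_def V_def partial_sum_def sum.Plus sum_negf)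

lemma indep_vars_V: "indep_vars (\<lambda>_. borel) V ({1..} <+> {1..})"
proof -
  let ?s = "\<lambda>j x. (case j of Inl _ \<Rightarrow> x | Inr _ \<Rightarrow> - x) :: real"
  have "indep_vars (\<lambda>_. borel) (\<lambda>j \<omega>. ?s j (case_sum X X' j \<omega>)) ({1..} <+> {1..})"
  proof (rule indep_vars_compose2[where M' = "\<lambda>_. borel" and Y = ?s])
    show "indep_vars (\<lambda>_. borel) (case_sum X X') ({1..} <+> {1..})"
      using iid by (simp add: iid_bernoulli_pair_def)
    show "?s j \<in> borel_measurable borel" for j :: "nat + nat"
      by (cases j) simp_all
  qed
  also have "(\<lambda>j \<omega>. ?s j (case_sum X X' j \<omega>)) = V"
    by (simp add: fun_eq_iff V_def split: sum.splits)
  finally show ?thesis .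
qed

lemma measurable_V: "j \<in> {1..} <+> {1..} \<Longrightarrow> random_variable borel (V j)"
  using indep_vars_V by (auto simp: indep_vars_def)

lemma measurable_X[measurable]: "i \<ge> 1 \<Longrightarrow> random_variable borel (X i)"
  and measurable_X'[measurable]: "i \<ge> 1 \<Longrightarrow> random_variable borel (X' i)"
proof -
  have *: "random_variable borel (case_sum X X' j)" if "j \<in> {1..} <+> {1..}" for j
    using iid that by (simp add: iid_bernoulli_pair_def indep_vars_def)
  show "i \<ge> 1 \<Longrightarrow> random_variable borel (X i)" "i \<ge> 1 \<Longrightarrow> random_variable borel (X' i)"
    using *[of "Inl i"] *[of "Inr i"] by auto
qed

lemma measurable_D[measurable]: "random_variable borel (D n)"
  unfolding D_eq_sum by (intro borel_measurable_sum measurable_V) auto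

lemma prob_V:
  assumes "i \<ge> 1"
  shows "\<P>(\<omega> in M. V (Inl i) \<omega> = 1) = \<alpha>" "\<P>(\<omega> in M. V (Inl i) \<omega> = 0) = 1 - \<alpha>"
    and "\<P>(\<omega> in M. V (Inr i) \<omega> = -1) = \<alpha>" "\<P>(\<omega> in M. V (Inr i) \<omega> = 0) = 1 - \<alpha>"
  using iid assms by (auto simp: iid_bernoulli_pair_def V_def)

lemma indep_var_sum_V:
  assumes "finite I" "j \<notin> I" "insert j I \<subseteq> {1..} <+> {1..}"
  shows "indep_var borel (V j) borel (\<lambda>\<omega>. \<Sum>i\<in>I. V i \<omega>)"
  by (intro indep_vars_sum indep_vars_subset[OF indep_vars_V] assms)

lemma prob_D_add_X:
  assumes "A \<in> sets borel"
  shows "\<P>(\<omega> in M. D n \<omega> + X (n + 1) \<omega> \<in> A)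
       = (1 - \<alpha>) * \<P>(\<omega> in M. D n \<omega> \<in> A) + \<alpha> * \<P>(\<omega> in M. D n \<omega> + 1 \<in> A)"
proof -
  have "indep_var (borel :: real measure) (V (Inl (n + 1))) borel (D n)"
    unfolding D_eq_sum by (rule indep_var_sum_V) auto
  from prob_add_two_valued[OF this prob_V(1,2) _ assms] show ?thesis
    by (simp add: V_def)
qed

text \<open>One step of a lazy symmetric random walk: the increment is 1 or -1 with probability
  \<open>\<alpha> * (1 - \<alpha>)\<close> each, and 0 otherwise. The two summands of the increment
  are added one at a time.\<close>

lemma prob_D_Suc:
  assumes A: "A \<in> sets borel"
  shows "\<P>(\<omega> in M. D (Suc n) \<omega> \<in> A)
       = (1 - 2 * (\<alpha> * (1 - \<alpha>))) * \<P>(\<omega> in M. D n \<omega> \<in> A)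
         + \<alpha> * (1 - \<alpha>) * (\<P>(\<omega> in M. D n \<omega> + 1 \<in> A) + \<P>(\<omega> in M. D n \<omega> - 1 \<in> A))"
proof -
  let ?Y = "\<lambda>\<omega>. D n \<omega> + X (n + 1) \<omega>"
  have "?Y = (\<lambda>\<omega>. \<Sum>j\<in>insert (Inl (n + 1)) ({1..n} <+> {1..n}). V j \<omega>)"
    by (subst sum.insert) (auto simp: D_eq_sum V_def)
  moreover have "indep_var borel (V (Inr (n + 1))) borel
      (\<lambda>\<omega>. \<Sum>j\<in>insert (Inl (n + 1)) ({1..n} <+> {1..n}). V j \<omega>)"
    by (rule indep_var_sum_V) auto
  ultimately have indep: "indep_var borel (V (Inr (n + 1))) borel ?Y"
    by (simp only:)
  have D: "D (Suc n) \<omega> = ?Y \<omega> + V (Inr (n + 1)) \<omega>" for \<omega>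
    by (simp add: D_def V_def partial_sum_def)
  \<comment> \<open>The case \<open>X' (n + 1) = 1\<close> asks for \<open>?Y - 1\<close> in
    \<open>A\<close>; as a condition on \<open>?Y\<close> itself it falls under
    \<open>prob_D_add_X\<close>.\<close>
  have A': "(\<lambda>y. y - 1) -` A \<in> sets borel"
    by (rule measurable_sets_borel[OF _ A]) measurable
  have "\<P>(\<omega> in M. D (Suc n) \<omega> \<in> A)
      = (1 - \<alpha>) * \<P>(\<omega> in M. ?Y \<omega> \<in> A) + \<alpha> * \<P>(\<omega> in M. ?Y \<omega> \<in> (\<lambda>y. y - 1) -` A)"
    unfolding D using prob_add_two_valued[OF indep prob_V(3,4) _ A] by simp
  then show ?thesis
    unfolding prob_D_add_X[OF A] prob_D_add_X[OF A'] by (simp add: algebra_simps)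
qed

lemma D_0: "D 0 \<omega> = 0"
  by (simp add: D_def partial_sum_def)

text \<open>The increments have a symmetric law. The set \<open>A\<close> varies in the induction
  because a step shifts it.\<close>

lemma prob_D_symmetric:
  assumes "A \<in> sets borel"
  shows "\<P>(\<omega> in M. - D n \<omega> \<in> A) = \<P>(\<omega> in M. D n \<omega> \<in> A)"
  using assms
proof (induction n arbitrary: A)
  case 0
  then show ?case by (simp add: D_0)
next
  case (Suc n)
  have vimage: "f -` A \<in> sets borel" if "f \<in> borel_measurable borel" for f :: "real \<Rightarrow> real"
    using measurable_sets_borel[OF that Suc.prems] .
  have neg: "- (x + 1) = - x - 1" "- (x - 1) = - x + 1" for x :: real
    by simp_all
  have "\<P>(\<omega> in M. - D n \<omega> - 1 \<in> A) = \<P>(\<omega> in M. D n \<omega> - 1 \<in> A)"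
    "\<P>(\<omega> in M. - D n \<omega> + 1 \<in> A) = \<P>(\<omega> in M. D n \<omega> + 1 \<in> A)"
    using Suc.IH[OF vimage, of "\<lambda>y. y - 1"] Suc.IH[OF vimage, of "\<lambda>y. y + 1"]
    by simp_all
  \<comment> \<open>This is the recursion for the reflected set; reflection exchanges the two unit
    shifts, which carry the same weight.\<close>
  moreover have "\<P>(\<omega> in M. - D (Suc n) \<omega> \<in> A)
       = (1 - 2 * (\<alpha> * (1 - \<alpha>))) * \<P>(\<omega> in M. - D n \<omega> \<in> A)
         + \<alpha> * (1 - \<alpha>) * (\<P>(\<omega> in M. - D n \<omega> - 1 \<in> A) + \<P>(\<omega> in M. - D n \<omega> + 1 \<in> A))"
    using prob_D_Suc[OF vimage[of uminus], of n] by (simp only: vimage_eq neg) simp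
  ultimately show ?case
    unfolding prob_D_Suc[OF Suc.prems] using Suc.IH[OF Suc.prems] by (simp only: add.commute)
qed

section \<open>Integrality and reduction of the winning probability to ties\<close>

lemma AE_partial_sum_Ints:
  "AE \<omega> in M. partial_sum X n \<omega> \<in> \<int>" "AE \<omega> in M. partial_sum X' n \<omega> \<in> \<int>"
proof -
  have "AE \<omega> in M. X i \<omega> \<in> \<int>" "AE \<omega> in M. X' i \<omega> \<in> \<int>" if "i \<in> {1..n}" for i
    using AE_two_valued[of "X i" 1 \<alpha> 0] AE_two_valued[of "X' i" 1 \<alpha> 0] iid that
    by (auto simp: iid_bernoulli_pair_def elim: eventually_mono)
  then have *: "AE \<omega> in M. \<forall>i\<in>{1..n}. X i \<omega> \<in> \<int>" "AE \<omega> in M. \<forall>i\<in>{1..n}. X' i \<omega> \<in> \<int>"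
    by (simp_all add: AE_ball_countable)
  show "AE \<omega> in M. partial_sum X n \<omega> \<in> \<int>"
    using *(1) by eventually_elim (auto simp: partial_sum_def intro!: Ints_sum)
  show "AE \<omega> in M. partial_sum X' n \<omega> \<in> \<int>"
    using *(2) by eventually_elim (auto simp: partial_sum_def intro!: Ints_sum)
qed

lemma AE_D_Ints: "AE \<omega> in M. D n \<omega> \<in> \<int>"
  using AE_partial_sum_Ints[of n] by eventually_elim (simp add: D_def)

lemma measurable_partial_sum[measurable]:
  "random_variable borel (partial_sum X n)" "random_variable borel (partial_sum X' n)"
  unfolding partial_sum_def[abs_def] by (intro borel_measurable_sum; simp)+

lemma win_prob_eq_less:
  "win_prob M X X' n = \<P>(\<omega> in M. partial_sum X (n + 1) \<omega> > partial_sum X' n \<omega>)"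
  unfolding win_prob_def
proof (rule prob_eq_AE)
  show "AE \<omega> in M. partial_sum X' n \<omega> + 1 \<le> partial_sum X (n + 1) \<omega> \<longleftrightarrow>
      partial_sum X' n \<omega> < partial_sum X (n + 1) \<omega>"
    using AE_partial_sum_Ints(1)[of "n + 1"] AE_partial_sum_Ints(2)[of n]
    by eventually_elim (auto elim!: Ints_cases)
qed measurable

text \<open>If \<open>X (n + 1)\<close> is 0, winning means \<open>D n > 0\<close>; if it is 1,
  integrality makes winning mean \<open>D n \<ge> 0\<close>. Symmetry then expresses the probability
  of \<open>D n > 0\<close> through that of a tie.\<close>

lemma win_prob_eq_tie:
  "win_prob M X X' n = 1/2 - (1/2 - \<alpha>) * \<P>(\<omega> in M. D n \<omega> = 0)"
proof -
  let ?pos = "\<P>(\<omega> in M. D n \<omega> > 0)" and ?tie = "\<P>(\<omega> in M. D n \<omega> = 0)"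
  have "win_prob M X X' n = \<P>(\<omega> in M. D n \<omega> + X (n + 1) \<omega> \<in> {0<..})"
    unfolding win_prob_eq_less by (simp add: D_def partial_sum_def algebra_simps)
  also have "\<dots> = (1 - \<alpha>) * ?pos + \<alpha> * \<P>(\<omega> in M. D n \<omega> + 1 > 0)"
    by (subst prob_D_add_X) auto
  also have "\<P>(\<omega> in M. D n \<omega> + 1 > 0) = \<P>(\<omega> in M. D n \<omega> > 0 \<or> D n \<omega> = 0)"
  proof (rule prob_eq_AE)
    show "AE \<omega> in M. D n \<omega> + 1 > 0 \<longleftrightarrow> D n \<omega> > 0 \<or> D n \<omega> = 0"
      using AE_D_Ints[of n]
    proof eventually_elim
      case (elim \<omega>)
      then obtain k where k: "D n \<omega> = of_int k"
        by (auto elim: Ints_cases)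
      have "real_of_int k + 1 > 0 \<longleftrightarrow> k > 0 \<or> k = 0"
        by linarith
      then show ?case
        unfolding k by simp
    qed
  qed measurable
  also have "\<dots> = prob ({\<omega> \<in> space M. D n \<omega> > 0} \<union> {\<omega> \<in> space M. D n \<omega> = 0})"
    by (auto intro: arg_cong[where f = prob])
  also have "\<dots> = ?pos + ?tie"
    by (intro finite_measure_Union) auto
  finally have win: "win_prob M X X' n = ?pos + \<alpha> * ?tie"
    by (simp add: algebra_simps)
  \<comment> \<open>By symmetry the complementary event \<open>D n < 0\<close> has probability
    \<open>?pos\<close>, so \<open>2 * ?pos + ?tie = 1\<close>.\<close>
  have "?pos + ?tie = prob ({\<omega> \<in> space M. D n \<omega> > 0} \<union> {\<omega> \<in> space M. D n \<omega> = 0})"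
    by (intro finite_measure_Union[symmetric]) auto
  also have "\<dots> = \<P>(\<omega> in M. \<not> D n \<omega> < 0)"
    by (auto intro!: arg_cong[where f = prob])
  also have "\<dots> = 1 - \<P>(\<omega> in M. D n \<omega> < 0)"
    by (rule prob_neg) measurable
  also have "\<P>(\<omega> in M. D n \<omega> < 0) = ?pos"
    using prob_D_symmetric[of "{0<..}" n] by simp
  finally show ?thesis
    using win by (simp add: algebra_simps)
qed

section \<open>Fourier inversion\<close>

text \<open>The characteristic function of one increment, written with the weights of
  \<open>prob_D_Suc\<close>.\<close>

definition f :: "real \<Rightarrow> real" where
  "f t = 1 - 2 * (\<alpha> * (1 - \<alpha>)) + 2 * (\<alpha> * (1 - \<alpha>)) * cos t"

lemma continuous_on_f[continuous_intros]: "continuous_on A f"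
  unfolding f_def[abs_def] by (intro continuous_intros)

lemma f_bounds: "0 \<le> f t \<and> f t \<le> 1"
proof -
  have "0 \<le> \<alpha> * (1 - \<alpha>)"
    using \<alpha> by simp
  moreover have "4 * (\<alpha> * (1 - \<alpha>)) \<le> 1"
    using zero_le_power2[of "1 - 2 * \<alpha>"] by (simp add: power2_eq_square algebra_simps)
  moreover have "\<alpha> * (1 - \<alpha>) * cos t \<le> \<alpha> * (1 - \<alpha>) * 1"
    "\<alpha> * (1 - \<alpha>) * (- 1) \<le> \<alpha> * (1 - \<alpha>) * cos t"
    using \<alpha> by (intro mult_left_mono; simp)+
  ultimately show ?thesis
    unfolding f_def by linarith
qed

lemma f_pi: "f pi = (1 - 2 * \<alpha>)\<^sup>2"
  by (simp add: f_def power2_eq_square algebra_simps)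

text \<open>Both sides satisfy the same recursion in \<open>n\<close>, and at \<open>n = 0\<close>
  both are \<open>2 * pi\<close> for \<open>k = 0\<close> and zero otherwise. Ties are the case
  \<open>k = 0\<close>, but the recursion couples neighbouring \<open>k\<close>, so the induction
  treats all integers at once.\<close>

lemma prob_D_eq_integral:
  "2 * pi * \<P>(\<omega> in M. D n \<omega> = of_int k) = integral {-pi..pi} (\<lambda>t. cos (of_int k * t) * f t ^ n)"
proof (induction n arbitrary: k)
  case 0
  have "integral {-pi..pi} (\<lambda>t. cos (of_int k * t)) = (if k = 0 then 2 * pi else 0)"
    by (rule integral_unique[OF has_integral_cos_nx])
  then show ?case
    by (auto simp: D_0 prob_space)
next
  case (Suc n)
  define a where "a = \<alpha> * (1 - \<alpha>)"
  define I where "I k = integral {-pi..pi} (\<lambda>t. cos (of_int k * t) * f t ^ n)" for k :: int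
  have I: "((\<lambda>t. cos (of_int k * t) * f t ^ n) has_integral I k) {-pi..pi}" for k
    unfolding I_def
    by (intro integrable_integral integrable_continuous_real continuous_intros)
  have "((\<lambda>t. (1 - 2 * a) * (cos (of_int k * t) * f t ^ n)
      + a * (cos (of_int (k - 1) * t) * f t ^ n + cos (of_int (k + 1) * t) * f t ^ n))
      has_integral (1 - 2 * a) * I k + a * (I (k - 1) + I (k + 1))) {-pi..pi}"
    by (intro has_integral_add has_integral_mult_right I)
  also have "(\<lambda>t. (1 - 2 * a) * (cos (of_int k * t) * f t ^ n)
      + a * (cos (of_int (k - 1) * t) * f t ^ n + cos (of_int (k + 1) * t) * f t ^ n))
      = (\<lambda>t. cos (of_int k * t) * f t ^ Suc n)"
  proof
    fix t :: real
    \<comment> \<open>Multiplication by \<open>2 * cos t\<close> passes to the two neighbouring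
      frequencies, just as a nonzero increment passes to the two neighbouring sites.\<close>
    have cos_sum: "cos (of_int (k - 1) * t) + cos (of_int (k + 1) * t)
        = 2 * cos t * cos (of_int k * t)"
      by (simp add: left_diff_distrib distrib_right cos_add cos_diff)
    have "(1 - 2 * a) * cos (of_int k * t)
        + a * (cos (of_int (k - 1) * t) + cos (of_int (k + 1) * t)) = cos (of_int k * t) * f t"
      unfolding cos_sum f_def a_def[symmetric] by (simp add: algebra_simps)
    then have "((1 - 2 * a) * cos (of_int k * t)
        + a * (cos (of_int (k - 1) * t) + cos (of_int (k + 1) * t))) * f t ^ n
        = cos (of_int k * t) * f t * f t ^ n"
      by (rule arg_cong)
    then show "(1 - 2 * a) * (cos (of_int k * t) * f t ^ n)
        + a * (cos (of_int (k - 1) * t) * f t ^ n + cos (of_int (k + 1) * t) * f t ^ n)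
        = cos (of_int k * t) * f t ^ Suc n"
      by (simp only: distrib_right distrib_left mult.assoc power_Suc)
  qed
  finally have "integral {-pi..pi} (\<lambda>t. cos (of_int k * t) * f t ^ Suc n)
      = (1 - 2 * a) * I k + a * (I (k - 1) + I (k + 1))"
    by (rule integral_unique)
  also have "\<dots> = 2 * pi * ((1 - 2 * a) * \<P>(\<omega> in M. D n \<omega> = of_int k)
      + a * (\<P>(\<omega> in M. D n \<omega> = of_int (k - 1)) + \<P>(\<omega> in M. D n \<omega> = of_int (k + 1))))"
    unfolding I_def Suc.IH[symmetric] by (simp add: algebra_simps)
  also have "\<dots> = 2 * pi * \<P>(\<omega> in M. D (Suc n) \<omega> = of_int k)"
    using prob_D_Suc[of "{of_int k}" n] by (simp add: a_def eq_diff_eq diff_eq_eq)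
  finally show ?case ..
qed

section \<open>Monotonicity and convexity of the tie probabilities\<close>

definition q :: "nat \<Rightarrow> real" where
  "q n = \<P>(\<omega> in M. D n \<omega> = 0)"

lemma q_eq_integral: "q n = integral {-pi..pi} (\<lambda>t. f t ^ n) / (2 * pi)"
  using prob_D_eq_integral[of n 0] by (simp add: q_def field_simps)

lemma q_strict_antimono:
  assumes "\<alpha> \<noteq> 1/2" and "m < n"
  shows "q n < q m"
\<comment> \<open>The lifting rule concerns increasing sequences, hence the negation.\<close>
proof (rule lift_Suc_mono_less[of "\<lambda>n. - q n", OF _ \<open>m < n\<close>, simplified])
  fix n
  \<comment> \<open>The witness for strictness is \<open>pi\<close>:
    \<open>f pi = (1 - 2 * \<alpha>)\<^sup>2\<close> is positive as
    \<open>\<alpha> \<noteq> 1/2\<close>, and below 1 as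
    \<open>\<alpha> * (1 - \<alpha>) > 0\<close>.\<close>
  have "f pi > 0"
    using assms by (simp add: f_pi)
  moreover have "1 - f pi = 4 * (\<alpha> * (1 - \<alpha>))"
    by (simp add: f_pi power2_eq_square algebra_simps)
  then have "f pi < 1"
    using \<alpha> mult_pos_pos[of \<alpha> "1 - \<alpha>"] by linarith
  ultimately have "integral {-pi..pi} (\<lambda>t. f t ^ Suc n) < integral {-pi..pi} (\<lambda>t. f t ^ n)"
    using f_bounds by (intro integral_power_strict_antimono[of _ _ _ pi] continuous_intros) auto
  then show "q (Suc n) < q n"
    by (simp add: q_eq_integral divide_strict_right_mono)
qed

lemma q_convex: "m \<le> n \<Longrightarrow> q (m + 1) - q m \<le> q (n + 1) - q n"
  using monoD[OF integral_power_convex[OF continuous_on_f f_bounds], of m n "-pi" pi]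
  by (simp add: q_eq_integral divide_right_mono flip: diff_divide_distrib)

text \<open>The sign of \<open>1/2 - \<alpha>\<close> alone decides how the behaviour of
  \<open>q\<close> passes to the winning probabilities; note the reversed order of \<open>m\<close>
  and \<open>n\<close> on the right.\<close>

lemma win_prob_diff:
  "win_prob M X X' n - win_prob M X X' m = (1/2 - \<alpha>) * (q m - q n)"
  by (simp add: win_prob_eq_tie algebra_simps flip: q_def)

end

theorem theorem2:
  fixes M :: "'a measure" and X X' :: "nat \<Rightarrow> 'a \<Rightarrow> real" and \<alpha> :: real and p :: "nat \<Rightarrow> real"
  assumes "prob_space M"
    and "0 < \<alpha>" and "\<alpha> < 1"
    and "iid_bernoulli_pair M \<alpha> X X'"
    and "p = win_prob M X X'"
  shows "(\<forall>n\<ge>1. p n = \<P>(\<omega> in M. partial_sum X (n + 1) \<omega> > partial_sum X' n \<omega>)) \<and>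
    (\<alpha> < 1/2 \<longrightarrow> strict_mono_on {1..} p \<and> concave_seq p) \<and>
    (\<alpha> > 1/2 \<longrightarrow> strict_antimono_on {1..} p \<and> convex_seq p) \<and>
    (\<alpha> = 1/2 \<longrightarrow> (\<forall>n\<ge>1. p n = 1/2))"
proof -
  interpret bernoulli_pair M X X' \<alpha>
    using assms by (simp add: bernoulli_pair_def bernoulli_pair_axioms_def)
  have p_diff: "p n - p m = (1/2 - \<alpha>) * (q m - q n)" for m n
    unfolding assms(5) by (rule win_prob_diff)
  have "strict_mono_on {1..} p \<and> concave_seq p" if "\<alpha> < 1/2"
  proof
    have "p m < p n" if "m < n" for m n
    proof -
      have "0 < (1/2 - \<alpha>) * (q m - q n)"
        using q_strict_antimono[OF _ that] \<open>\<alpha> < 1/2\<close> by (intro mult_pos_pos) auto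
      then show ?thesis
        using p_diff[of n m] by linarith
    qed
    then show "strict_mono_on {1..} p"
      by (simp add: monotone_on_def)
    show "concave_seq p"
      \<comment> \<open>Successive differences become
        \<open>(1/2 - \<alpha>) * (q n - q (n + 1))\<close>: a positive factor times a nonincreasing
        sequence.\<close>
      unfolding concave_seq_def monotone_on_def p_diff
      using that q_convex by (force intro: mult_left_mono)
  qed
  moreover have "strict_antimono_on {1..} p \<and> convex_seq p" if "\<alpha> > 1/2"
  proof
    have "p n < p m" if "m < n" for m n
    proof -
      have "(1/2 - \<alpha>) * (q m - q n) < 0"
        using q_strict_antimono[OF _ that] \<open>\<alpha> > 1/2\<close> by (intro mult_neg_pos) auto
      then show ?thesis
        using p_diff[of n m] by linarith
    qed
    then show "strict_antimono_on {1..} p"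
      by (simp add: monotone_on_def)
    show "convex_seq p"
      \<comment> \<open>The same formula, now with a negative factor that reverses the
        inequality.\<close>
      unfolding convex_seq_def monotone_on_def p_diff
      using that q_convex by (force intro: mult_left_mono_neg)
  qed
  moreover have "p n = 1/2" if "\<alpha> = 1/2" for n
    unfolding assms(5) win_prob_eq_tie using that by simp
  ultimately show ?thesis
    by (simp add: assms(5) win_prob_eq_less)
qed

end
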